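(* For every odd prime $p$, the Wagstaff number with exponent $p$, $$\zeta(p,2,1)=\frac{2^p+1}{3},$$ is primover base $2$.
   Context: $\zeta(n,k,h)$ is the product, counted with multiplicity, of the primitive prime divisors of $k^n+h^n$, i.e. of the primes dividing $k^n+h^n$ and dividing no $k^u+h^u$ with $1\le u<n$. For $n$ coprime to $k$, let $O_n(k)$ be the multiplicative order of $k$ modulo $n$ and let $r_k(n)$ be the number of distinct cyclotomic cosets of $k$ modulo $n$ on the nonzero residues (orbits of multiplication by $k$ on $\{1,\dots,n-1\}$ modulo $n$). A composite number $n$ coprime to $k$ is overpseudoprime base $k$ if $n=r_k(n)O_n(k)+1$; equivalently, $O_d(k)=O_n(k)$ for every divisor $d>1$ of $n$. A number is primover base $k$ if it is prime or a composite overpseudoprime base $k$.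
   Formalization: The identity ζ(p,2,1) = (2^p+1)/3 is asserted only for p ≠ 3, since it fails at p = 3 (9 has no primitive prime divisor, so ζ(3,2,1) = 1, not 3); that (2^p+1)/3 is primover base 2 is proved for every odd prime p, including 3. *)

theory Defs
  imports "HOL-Number_Theory.Number_Theory"
begin

definition primitive_prime_divisors :: "nat \<Rightarrow> nat \<Rightarrow> nat \<Rightarrow> nat set" where
  "primitive_prime_divisors n k h =
     {q. prime q \<and> q dvd k ^ n + h ^ n \<and> (\<forall>u. 1 \<le> u \<and> u < n \<longrightarrow> \<not> q dvd k ^ u + h ^ u)}"

definition zeta :: "nat \<Rightarrow> nat \<Rightarrow> nat \<Rightarrow> nat" where
  "zeta n k h = (\<Prod>q \<in> primitive_prime_divisors n k h. q ^ multiplicity q (k ^ n + h ^ n))"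

definition cyclotomic_coset :: "nat \<Rightarrow> nat \<Rightarrow> nat \<Rightarrow> nat set" where
  "cyclotomic_coset k n a = range (\<lambda>i::nat. (a * k ^ i) mod n)"

definition num_cyclotomic_cosets :: "nat \<Rightarrow> nat \<Rightarrow> nat" where
  "num_cyclotomic_cosets k n = card (cyclotomic_coset k n ` {1..<n})"

definition overpseudoprime :: "nat \<Rightarrow> nat \<Rightarrow> bool" where
  "overpseudoprime k n \<longleftrightarrow>
     1 < n \<and> \<not> prime n \<and> coprime n k \<and> n = num_cyclotomic_cosets k n * ord n k + 1"

definition primover :: "nat \<Rightarrow> nat \<Rightarrow> bool" where
  "primover k n \<longleftrightarrow> prime n \<or> overpseudoprime k n"

text \<open>
  The exponent 3 is degenerate: the only prime factor of \<open>2 ^ 3 + 1 = 9\<close> already divides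
  \<open>2 ^ 1 + 1\<close>, so there is no primitive prime divisor, whereas \<open>(2 ^ 3 + 1) div 3 = 3\<close>.
\<close>

lemma zeta_3_2_1: "zeta 3 2 1 = 1"
proof -
  have False if "q \<in> primitive_prime_divisors 3 2 1" for q
  proof -
    from that have q: "prime q" "q dvd 3 ^ 2" "\<not> q dvd 2 ^ 1 + 1 ^ 1"
      unfolding primitive_prime_divisors_def by auto
    from q(1,2) have "q dvd 3" by (rule prime_dvd_power)
    with q(3) show False by simp
  qed
  then have "primitive_prime_divisors 3 2 1 = {}" by blast
  then show ?thesis by (simp add: zeta_def)
qed

end

theory Submission
  imports Defs
begin

text \<open>
  A prime \<open>q \<noteq> 3\<close> dividing \<open>2 ^ p + 1\<close> has \<open>ord q 2\<close> dividing \<open>2 * p\<close> but dividing neither \<open>p\<close>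
  nor \<open>2\<close>, so \<open>ord q 2 = 2 * p\<close>. Since \<open>(2 ^ p + 1) div 3 \<equiv> p\<close> modulo 3, for \<open>p \<noteq> 3\<close> every
  divisor \<open>d > 1\<close> of the Wagstaff number satisfies \<open>ord d 2 = 2 * p\<close>. The coset of \<open>a\<close> modulo
  \<open>n\<close> has \<open>ord (n div gcd a n) k\<close> elements, so when all these orders agree the cosets cut the
  \<open>n - 1\<close> nonzero residues into blocks of size \<open>ord n k\<close>.
\<close>

section \<open>Cyclotomic cosets as a partition of the nonzero residues\<close>

lemma cyclotomic_coset_self:
  assumes "a < n"
  shows "a \<in> cyclotomic_coset k n a"
  unfolding cyclotomic_coset_def using assms by (intro image_eqI[of _ _ 0]) auto

lemma cyclotomic_coset_subset:
  assumes "coprime n k" "a \<in> {1..<n}"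
  shows "cyclotomic_coset k n a \<subseteq> {1..<n}"
proof -
  have "(a * k ^ i) mod n \<noteq> 0" for i
  proof
    assume "(a * k ^ i) mod n = 0"
    then have "n dvd a * k ^ i" by auto
    then have "n dvd a" using assms(1) by (simp add: coprime_dvd_mult_left_iff)
    then show False using assms(2) by (auto dest: dvd_imp_le)
  qed
  then show ?thesis using assms(2) unfolding cyclotomic_coset_def
    by (auto simp: Suc_le_eq)
qed

text \<open>As \<open>k\<close> is a unit modulo \<open>n\<close>, cosets are orbits of an
  invertible map, so two cosets sharing an element coincide. This gives the disjointness needed to
  count residues coset by coset.\<close>

lemma cyclotomic_coset_eq:
  assumes "coprime n k" "x \<in> cyclotomic_coset k n a"
  shows "cyclotomic_coset k n x = cyclotomic_coset k n a"
proof -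
  obtain i where x: "x = (a * k ^ i) mod n"
    using assms(2) unfolding cyclotomic_coset_def by auto
  have shift: "(x * k ^ j) mod n = (a * k ^ (i + j)) mod n" for j
    by (simp add: x mod_mult_left_eq power_add mult.assoc)
  \<comment> \<open>The factor \<open>k ^ (i * (ord n k - 1))\<close> is the inverse of
    \<open>k ^ i\<close> modulo \<open>n\<close>, so it leads from \<open>x\<close> back to
    \<open>a\<close>.\<close>
  have "(a * k ^ j) mod n = (x * k ^ (j + i * (ord n k - 1))) mod n" for j
  proof -
    have "ord n k > 0" using assms(1) by (simp add: ord_eq_0)
    then have e: "i + (j + i * (ord n k - 1)) = j + ord n k * i"
      by (cases "ord n k") (simp_all add: algebra_simps)
    have "[(k ^ ord n k) ^ i = 1 ^ i] (mod n)" by (intro cong_pow ord)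
    then have "[a * k ^ j * (k ^ ord n k) ^ i = a * k ^ j * 1 ^ i] (mod n)"
      by (intro cong_mult cong_refl)
    then show ?thesis unfolding shift e
      by (simp add: cong_def power_add power_mult mult.assoc)
  qed
  with shift show ?thesis unfolding cyclotomic_coset_def by (auto simp: image_iff)
qed

text \<open>Cancelling \<open>g = gcd a n\<close> replaces \<open>a\<close> modulo \<open>n\<close>
  by a unit \<open>b\<close> modulo \<open>d = n div g\<close>. Hence \<open>a * k ^ i\<close>
  repeats modulo \<open>n\<close> exactly with period \<open>ord d k\<close>, which
  \<open>ord_eq\<close> identifies with \<open>ord n k\<close>.\<close>

lemma card_cyclotomic_coset:
  assumes "coprime n k" "a \<in> {1..<n}" and ord_eq: "ord (n div gcd a n) k = ord n k"
  shows "card (cyclotomic_coset k n a) = ord n k"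
proof -
  define g where "g = gcd a n"
  have g: "g > 0" using assms(2) by (auto simp: g_def)
  obtain b d where bd: "a = g * b" "n = g * d" unfolding g_def by (meson dvdE gcd_dvd1 gcd_dvd2)
  have "gcd a n = g * gcd b d" unfolding bd by (simp add: gcd_mult_distrib_nat)
  then have "g * gcd b d = g * 1" by (simp only: g_def[symmetric] mult_1_right)
  then have "gcd b d = 1" using g by simp
  then have "coprime b d" by (simp only: coprime_iff_gcd_eq_1)
  have "coprime d k" using assms(1) bd by simp
  have "n div g = d" using g bd(2) by simp
  then have ordd: "ord d k = ord n k" using ord_eq by (simp flip: g_def)
  have pos: "ord n k > 0" using assms(1) by (simp add: ord_eq_0)
  have "inj_on (\<lambda>i. (a * k ^ i) mod n) {..<ord n k}"
  proof (rule inj_onI)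
    fix i j assume ij: "i \<in> {..<ord n k}" "j \<in> {..<ord n k}"
      and "(a * k ^ i) mod n = (a * k ^ j) mod n"
    then have "[b * k ^ i = b * k ^ j] (mod d)"
      using g by (simp add: bd cong_def mult.assoc flip: mult_mod_right)
    then have "[k ^ i = k ^ j] (mod d)"
      using \<open>coprime b d\<close> by (simp add: cong_mult_lcancel_nat)
    then have "[i = j] (mod ord n k)"
      using order_divides_expdiff[OF \<open>coprime d k\<close>] ordd by simp
    then show "i = j" using ij by (simp add: cong_def)
  qed
  moreover have "cyclotomic_coset k n a = (\<lambda>i. (a * k ^ i) mod n) ` {..<ord n k}"
  proof -
    have "(a * k ^ i) mod n = (a * k ^ (i mod ord n k)) mod n" for i
    proof -
      have "[k ^ i = k ^ (i mod ord n k)] (mod n)"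
        using order_divides_expdiff[OF assms(1)] by (simp add: cong_def)
      then have "[a * k ^ i = a * k ^ (i mod ord n k)] (mod n)" by (intro cong_mult cong_refl)
      then show ?thesis by (simp add: cong_def)
    qed
    moreover have "i mod ord n k \<in> {..<ord n k}" for i using pos by simp
    ultimately have "range (\<lambda>i. (a * k ^ i) mod n) \<subseteq> (\<lambda>i. (a * k ^ i) mod n) ` {..<ord n k}"
      by (intro image_subsetI) (rule image_eqI)
    then show ?thesis unfolding cyclotomic_coset_def by blast
  qed
  ultimately show ?thesis by (simp add: card_image)
qed

lemma num_cyclotomic_cosets_mult_ord:
  assumes "coprime n k" "1 < n"
    and ord_eq: "\<And>d. d dvd n \<Longrightarrow> 1 < d \<Longrightarrow> ord d k = ord n k"
  shows "n = num_cyclotomic_cosets k n * ord n k + 1"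
proof -
  let ?C = "cyclotomic_coset k n ` {1..<n}"
  have Un: "\<Union> ?C = {1..<n}"
    using cyclotomic_coset_subset[OF assms(1)] cyclotomic_coset_self[of _ n k] by fastforce
  have "ord n k * card ?C = card (\<Union> ?C)"
  proof (rule card_partition)
    fix c assume "c \<in> ?C"
    then obtain a where a: "a \<in> {1..<n}" "c = cyclotomic_coset k n a" by auto
    have "n div gcd a n dvd n" by (metis dvd_div_mult_self dvd_triv_left gcd_dvd2)
    \<comment> \<open>Otherwise \<open>n\<close> would divide \<open>a\<close>, which lies strictly
      between 0 and \<open>n\<close>.\<close>
    moreover have "1 < n div gcd a n"
    proof (rule ccontr)
      assume "\<not> 1 < n div gcd a n"
      then have "n div gcd a n = 0 \<or> n div gcd a n = 1" by linarith
      then have "n = 0 \<or> n = gcd a n"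
        using dvd_mult_div_cancel[OF gcd_dvd2[of a n]] by (elim disjE) simp_all
      then have "n dvd a" using assms(2) by (metis gcd_dvd1 not_less_zero)
      then show False using a by (auto dest: dvd_imp_le)
    qed
    ultimately show "card c = ord n k"
      unfolding a(2) by (intro card_cyclotomic_coset assms(1) a(1) ord_eq)
  next
    fix c d assume "c \<in> ?C" "d \<in> ?C" "c \<noteq> d"
    then show "c \<inter> d = {}" using cyclotomic_coset_eq[OF assms(1)] by blast
  qed (use Un in auto)
  then show ?thesis using assms(2) Un unfolding num_cyclotomic_cosets_def
    by (simp add: mult.commute)
qed

section \<open>The power of 3 in \<open>2 ^ p + 1\<close>\<close>

text \<open>For \<open>p = 2 * m + 1\<close> one has \<open>2 ^ p = 2 * (1 + 3) ^ m\<close>, and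
  modulo 9 only the first two binomial terms survive. Working modulo 9 shows both that 3 divides
  \<open>2 ^ p + 1\<close> and when 9 does.\<close>

lemma two_power_odd_plus_one_mod_9:
  fixes p :: nat
  assumes "odd p"
  shows "[2 ^ p + 1 = 3 * p] (mod 9)"
proof -
  obtain m where m: "p = 2 * m + 1" using assms by (auto elim: oddE)
  have "[4 ^ m = 1 + 3 * m] (mod (9::nat))"
  proof (induction m)
    case (Suc m)
    have "[4 * 4 ^ m = 4 * (1 + 3 * m)] (mod (9::nat))" using Suc by (intro cong_mult cong_refl)
    also have "4 * (1 + 3 * m) = 1 + 3 * Suc m + 9 * m" by simp
    also have "[1 + 3 * Suc m + 9 * m = 1 + 3 * Suc m] (mod 9)" by (metis cong_mult_self_left cong_add_lcancel_0_nat)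
    finally show ?case by simp
  qed simp
  then have "[2 * 4 ^ m + 1 = 2 * (1 + 3 * m) + 1] (mod (9::nat))"
    by (intro cong_add cong_mult cong_refl)
  then show ?thesis by (simp add: m power_mult numeral_3_eq_3)
qed

lemma three_dvd_two_power_odd_plus_one:
  fixes p :: nat
  assumes "odd p"
  shows "3 dvd (2::nat) ^ p + 1"
proof -
  have "[2 ^ p + 1 = 3 * p] (mod 3)"
    using two_power_odd_plus_one_mod_9[OF assms] by (rule cong_dvd_modulus_nat) simp
  then show ?thesis by (simp only: cong_dvd_iff dvd_triv_left)
qed

lemma not_three_dvd_Wagstaff:
  fixes p :: nat
  assumes p: "prime p" "odd p" "p \<noteq> 3"
  shows "\<not> 3 dvd ((2::nat) ^ p + 1) div 3"
proof -
  have "3 dvd ((2::nat) ^ p + 1) div 3 \<longleftrightarrow> 9 dvd (2::nat) ^ p + 1"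
    using three_dvd_two_power_odd_plus_one[OF p(2)] by (simp only: dvd_div_iff_mult) simp
  also have "\<dots> \<longleftrightarrow> 3 * 3 dvd 3 * p"
    using cong_dvd_iff[OF two_power_odd_plus_one_mod_9[OF p(2)]] by simp
  also have "\<dots> \<longleftrightarrow> 3 dvd p" by (rule nat_mult_dvd_cancel1) simp
  also have "\<dots> \<longleftrightarrow> False" using p primes_dvd_imp_eq[of 3 p] by auto
  finally show ?thesis by simp
qed

section \<open>Orders of 2 modulo divisors of \<open>2 ^ p + 1\<close>\<close>

lemma ord_dvd_double_exponent:
  fixes q u :: nat
  assumes "q dvd 2 ^ u + 1"
  shows "ord q 2 dvd 2 * u"
proof -
  \<comment> \<open>Here \<open>x\<close> is \<open>2 ^ u - 1\<close>, so the next identity is the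
    difference of two squares without natural subtraction.\<close>
  obtain x where x: "(2::nat) ^ u = Suc x" using not0_implies_Suc[of "2 ^ u"] by auto
  have "(2::nat) ^ (2 * u) = x * (2 ^ u + 1) + 1"
    by (simp add: mult.commute[of 2] power_mult x power2_eq_square)
  moreover have "[x * (2 ^ u + 1) + 1 = 0 + 1] (mod q)"
    using assms by (intro cong_add cong_refl) (simp only: cong_0_iff dvd_mult)
  ultimately have "[2 ^ (2 * u) = 1] (mod q)" by simp
  then show ?thesis by (simp only: ord_divides)
qed

lemma ord_prime_divisor_Wagstaff:
  fixes p q :: nat
  assumes p: "prime p" "odd p" and q: "prime q" "q dvd 2 ^ p + 1" "q \<noteq> 3"
  shows "ord q 2 = 2 * p"
proof -
  have "q \<noteq> 2" using q(2) prime_gt_0_nat[OF p(1)] by auto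
  then have "q > 2" using prime_ge_2_nat[OF q(1)] by simp
  have "ord q 2 dvd 2 * p" using q(2) by (rule ord_dvd_double_exponent)
  then obtain m where m: "2 * p = ord q 2 * m" by (elim dvdE)
  have not_dvd_p: "\<not> ord q 2 dvd p"
  proof
    assume "ord q 2 dvd p"
    then have "[2 ^ p = 1] (mod q)" by (simp only: ord_divides)
    then have "[2 ^ p + 1 = 1 + 1] (mod q)" by (intro cong_add cong_refl)
    then have "q dvd 1 + 1" using q(2) by (simp only: cong_dvd_iff)
    then show False using \<open>q > 2\<close> by (auto dest: dvd_imp_le)
  qed
  have not_dvd_2: "\<not> ord q 2 dvd 2"
  proof
    assume "ord q 2 dvd 2"
    then have "[2 ^ 2 = 1] (mod q)" by (simp only: ord_divides)
    then have "q dvd 3" by (simp add: cong_altdef_nat)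
    then show False using q primes_dvd_imp_eq[of q 3] by simp
  qed
  \<comment> \<open>If \<open>p\<close> divides the order, the order is \<open>p\<close> or
    \<open>2 * p\<close>, and \<open>not_dvd_p\<close> excludes \<open>p\<close>. If
    \<open>p\<close> divides the cofactor \<open>m\<close>, the order divides 2, against
    \<open>not_dvd_2\<close>.\<close>
  have "p dvd ord q 2 * m" by (simp flip: m)
  then consider "p dvd ord q 2" | "p dvd m" using p(1) by (auto simp: prime_dvd_mult_iff)
  then show ?thesis
  proof cases
    case 1
    then obtain t where t: "ord q 2 = p * t" by (elim dvdE)
    then have "2 = t * m" using m prime_gt_0_nat[OF p(1)] by simp
    then have "t dvd 2" by (metis dvd_triv_left)
    then have "t = 1 \<or> t = 2" using two_is_prime_nat prime_nat_iff by blast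
    then show ?thesis using t not_dvd_p by auto
  next
    case 2
    then obtain t where "m = p * t" by (elim dvdE)
    then have "2 = ord q 2 * t" using m prime_gt_0_nat[OF p(1)] by simp
    then show ?thesis using not_dvd_2 by (metis dvd_triv_left)
  qed
qed

section \<open>Primitive divisors and the value of \<open>zeta\<close>\<close>

text \<open>The prime 3 is not primitive because it equals \<open>2 ^ 1 + 1\<close>. Any other prime
  factor has order \<open>2 * p\<close>, so dividing \<open>2 ^ u + 1\<close> would force
  \<open>p\<close> to divide \<open>u\<close>.\<close>

lemma primitive_prime_divisors_Wagstaff:
  assumes p: "prime p" "odd p" "p \<noteq> 3"
  shows "primitive_prime_divisors p 2 1 = prime_factors ((2 ^ p + 1) div 3)"
proof -
  define W where "W = ((2::nat) ^ p + 1) div 3"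
  have N: "(2::nat) ^ p + 1 = 3 * W"
    unfolding W_def using three_dvd_two_power_odd_plus_one[OF p(2)] by simp
  have "W \<noteq> 0" using N by auto
  have W3: "\<not> 3 dvd W" unfolding W_def using p by (rule not_three_dvd_Wagstaff)
  have "q \<in> primitive_prime_divisors p 2 1 \<longleftrightarrow> prime q \<and> q dvd W" for q
  proof
    assume "q \<in> primitive_prime_divisors p 2 1"
    then have q: "prime q" "q dvd 3 * W" "\<And>u. 1 \<le> u \<Longrightarrow> u < p \<Longrightarrow> \<not> q dvd 2 ^ u + 1"
      unfolding primitive_prime_divisors_def by (auto simp flip: N)
    have "\<not> q dvd 3" using q(3)[of 1] prime_gt_1_nat[OF p(1)] by simp
    then show "prime q \<and> q dvd W" using q by (auto simp: prime_dvd_mult_iff)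
  next
    assume q: "prime q \<and> q dvd W"
    then have "q \<noteq> 3" using W3 by auto
    have "\<not> q dvd 2 ^ u + 1" if u: "1 \<le> u" "u < p" for u
    proof
      assume "q dvd 2 ^ u + 1"
      then have "ord q 2 dvd 2 * u" by (rule ord_dvd_double_exponent)
      moreover have "ord q 2 = 2 * p"
        using ord_prime_divisor_Wagstaff[OF p(1,2)] q N \<open>q \<noteq> 3\<close> by simp
      ultimately have "p dvd u" by simp
      then show False using u by (auto dest: dvd_imp_le)
    qed
    then show "q \<in> primitive_prime_divisors p 2 1"
      using q N unfolding primitive_prime_divisors_def by simp
  qed
  then show ?thesis using \<open>W \<noteq> 0\<close> unfolding W_def[symmetric]
    by (auto simp: prime_factors_dvd)
qed

lemma zeta_Wagstaff:
  assumes p: "prime p" "odd p" "p \<noteq> 3"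
  shows "zeta p 2 1 = (2 ^ p + 1) div 3"
proof -
  define W where "W = ((2::nat) ^ p + 1) div 3"
  have N: "(2::nat) ^ p + 1 ^ p = 3 * W"
    unfolding W_def using three_dvd_two_power_odd_plus_one[OF p(2)] by simp
  have "W \<noteq> 0" using N by auto
  have W3: "\<not> 3 dvd W" unfolding W_def using p by (rule not_three_dvd_Wagstaff)
  \<comment> \<open>\<open>zeta\<close> takes multiplicities in \<open>2 ^ p + 1\<close>; they agree
    with those in \<open>W\<close> because 3 is not among the primes concerned.\<close>
  have "multiplicity q (3 * W) = multiplicity q W" if "q \<in> prime_factors W" for q
  proof -
    have q: "prime q" "q dvd W" using that by (auto simp: prime_factors_dvd)
    then have "\<not> q dvd 3" using W3 primes_dvd_imp_eq[of q 3] by auto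
    then show ?thesis using q(1) \<open>W \<noteq> 0\<close>
      by (simp add: prime_elem_multiplicity_mult_distrib not_dvd_imp_multiplicity_0)
  qed
  then have "zeta p 2 1 = (\<Prod>q\<in>prime_factors W. q ^ multiplicity q W)"
    unfolding zeta_def primitive_prime_divisors_Wagstaff[OF p] N W_def[symmetric] by simp
  also have "\<dots> = W" using \<open>W \<noteq> 0\<close> by (simp flip: prime_factorization_nat)
  finally show ?thesis unfolding W_def .
qed

section \<open>Wagstaff numbers are primover\<close>

lemma primover_Wagstaff:
  assumes p: "prime p" "odd p"
  shows "primover 2 ((2 ^ p + 1) div 3)"
proof (cases "p = 3")
  \<comment> \<open>For \<open>p = 3\<close> the number is the prime 3, modulo which 2 has order 2
    rather than \<open>2 * p\<close>.\<close>
  case True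
  then show ?thesis by (simp add: primover_def)
next
  case False
  define W where "W = ((2::nat) ^ p + 1) div 3"
  have N: "(2::nat) ^ p + 1 = 3 * W"
    unfolding W_def using three_dvd_two_power_odd_plus_one[OF p(2)] by simp
  have W3: "\<not> 3 dvd W" unfolding W_def using p False by (rule not_three_dvd_Wagstaff)
  have "p \<ge> 3" using p prime_ge_2_nat[OF p(1)] by (cases "p = 2") auto
  then have "(2::nat) ^ 3 \<le> 2 ^ p" by (intro power_increasing) auto
  then have "1 < W" using N by simp
  \<comment> \<open>The order is squeezed: for a prime \<open>q\<close> dividing \<open>d\<close>,
    \<open>2 * p = ord q 2\<close> divides \<open>ord d 2\<close>, which divides
    \<open>2 * p\<close>.\<close>
  have ord_dvd: "ord d 2 = 2 * p" if d: "d dvd W" "1 < d" for d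
  proof -
    obtain q where q: "prime q" "q dvd d" using d(2) prime_factor_nat[of d] by auto
    have "q dvd W" using q d dvd_trans by blast
    then have "ord q 2 = 2 * p"
      using ord_prime_divisor_Wagstaff[OF p q(1)] N W3 by (cases "q = 3") auto
    moreover have "ord q 2 dvd ord d 2"
      using cong_dvd_modulus_nat[OF ord q(2)] by (simp only: ord_divides)
    moreover have "ord d 2 dvd 2 * p"
      using ord_dvd_double_exponent[of d p] N d(1) by simp
    ultimately show ?thesis by (simp add: dvd_antisym)
  qed
  have "2 dvd (2::nat) ^ p" using \<open>p \<ge> 3\<close> by simp
  then have "odd (3 * W)" by (simp flip: N)
  then have "odd W" by simp
  then have "coprime W 2" by simp
  \<comment> \<open>The case \<open>d = W\<close> of \<open>ord_dvd\<close> supplies the common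
    order \<open>ord W 2\<close>. The formula covers prime and composite \<open>W\<close> alike; the
    split on primality comes only with \<open>primover_def\<close>.\<close>
  then have "W = num_cyclotomic_cosets 2 W * ord W 2 + 1"
    using \<open>1 < W\<close> ord_dvd by (intro num_cyclotomic_cosets_mult_ord) auto
  then show ?thesis using \<open>1 < W\<close> \<open>coprime W 2\<close>
    unfolding primover_def overpseudoprime_def W_def[symmetric] by blast
qed

theorem proposition11:
  fixes p :: nat
  assumes "prime p" and "odd p"
  shows "3 dvd (2::nat) ^ p + 1 \<and>
         (p \<noteq> 3 \<longrightarrow> zeta p 2 1 = (2 ^ p + 1) div 3) \<and>
         primover 2 ((2 ^ p + 1) div 3)"
  using three_dvd_two_power_odd_plus_one[OF assms(2)] zeta_Wagstaff[OF assms]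
    primover_Wagstaff[OF assms] by blast

end
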